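(* Let $G$ be a finite simple graph on $n$ vertices. Then $m_G[0,1) \cdot m_G(n-1,n] < n$.
   Context: For a finite simple undirected graph $G$ on $n$ vertices, its Laplacian matrix is $L_G = D - A$, where $A$ is the adjacency matrix and $D$ is the diagonal matrix of vertex degrees. For a real interval $I$, $m_G(I)$ denotes the number of Laplacian eigenvalues of $G$, counted with multiplicity, lying in $I$. *)

theory Defs
  imports "Graph_Theory.Pair_Digraph" "Jordan_Normal_Form.Char_Poly"
begin

text \<open>
  A finite simple undirected graph is a symmetric, loop-free finite digraph without parallel
  arcs (locale \<^locale>\<open>pair_graph\<close>): an edge between \<open>u\<close> and \<open>v\<close> is the pair of arcs
  \<open>(u, v)\<close>, \<open>(v, u)\<close>, so that the degree of a vertex is its out-degree.

  Matrices are indexed by \<open>{0..<n}\<close>, so they are formed with respect to a list \<open>vs\<close> that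
  enumerates the vertices.
\<close>

definition adjacency_matrix :: "'a pair_pre_digraph \<Rightarrow> 'a list \<Rightarrow> real mat" where
  "adjacency_matrix G vs = mat (length vs) (length vs)
     (\<lambda>(i, j). if (vs ! i, vs ! j) \<in> parcs G then 1 else 0)"

definition degree_matrix :: "'a pair_pre_digraph \<Rightarrow> 'a list \<Rightarrow> real mat" where
  "degree_matrix G vs = mat (length vs) (length vs)
     (\<lambda>(i, j). if i = j then real (out_degree (with_proj G) (vs ! i)) else 0)"

definition laplacian_matrix :: "'a pair_pre_digraph \<Rightarrow> 'a list \<Rightarrow> real mat" where
  "laplacian_matrix G vs = degree_matrix G vs - adjacency_matrix G vs"

text \<open>
  The multiset of real roots of the characteristic polynomial. As the Laplacian matrix is
  symmetric, these are all its eigenvalues. The enumeration chosen is irrelevant, see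
  \<open>laplacian_eigenvalues_eq\<close> below.
\<close>

definition laplacian_eigenvalues :: "'a pair_pre_digraph \<Rightarrow> real multiset" where
  "laplacian_eigenvalues G =
     proots (char_poly (laplacian_matrix G (SOME vs. distinct vs \<and> set vs = pverts G)))"

definition laplacian_count :: "'a pair_pre_digraph \<Rightarrow> real set \<Rightarrow> nat" where
  "laplacian_count G I = size {#x \<in># laplacian_eigenvalues G. x \<in> I#}"

lemma char_poly_laplacian_matrix_enum:
  assumes vs: "distinct vs" and ws: "distinct ws" and eq: "set vs = set ws"
  shows "char_poly (laplacian_matrix G vs) = char_poly (laplacian_matrix G ws)"
proof (rule char_poly_similar)
  define n where "n = length vs"
  have n: "length vs = n" "length ws = n"
    using distinct_card[OF vs] distinct_card[OF ws] eq by (simp_all add: n_def)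
  have "\<exists>f. \<forall>i<n. f i < n \<and> ws ! f i = vs ! i"
  proof (intro choice allI)
    fix i
    show "\<exists>k. i < n \<longrightarrow> k < n \<and> ws ! k = vs ! i"
    proof (cases "i < n")
      case True
      then have "vs ! i \<in> set ws" using n eq by (metis nth_mem)
      then show ?thesis using n by (auto simp: in_set_conv_nth)
    qed simp
  qed
  then obtain f where f: "\<And>i. i < n \<Longrightarrow> f i < n" "\<And>i. i < n \<Longrightarrow> ws ! f i = vs ! i" by blast
  have "\<exists>g. \<forall>j<n. g j < n \<and> vs ! g j = ws ! j"
  proof (intro choice allI)
    fix i
    show "\<exists>k. i < n \<longrightarrow> k < n \<and> vs ! k = ws ! i"
    proof (cases "i < n")
      case True
      then have "ws ! i \<in> set vs" using n eq by (metis nth_mem)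
      then show ?thesis using n by (auto simp: in_set_conv_nth)
    qed simp
  qed
  then obtain g where g: "\<And>j. j < n \<Longrightarrow> g j < n" "\<And>j. j < n \<Longrightarrow> vs ! g j = ws ! j" by blast
  have fg: "f (g j) = j" if "j < n" for j
    using that f g ws n by (metis nth_eq_iff_index_eq)
  have gf: "g (f i) = i" if "i < n" for i
    using that f g vs n by (metis nth_eq_iff_index_eq)
  define P :: "real mat" where "P = mat n n (\<lambda>(i, j). if j = f i then 1 else 0)"
  define Q :: "real mat" where "Q = mat n n (\<lambda>(i, j). if j = g i then 1 else 0)"
  define L where "L = laplacian_matrix G ws"
  have car: "P \<in> carrier_mat n n" "Q \<in> carrier_mat n n" "L \<in> carrier_mat n n"
    "laplacian_matrix G vs \<in> carrier_mat n n"
    using n by (auto simp: P_def Q_def L_def laplacian_matrix_def degree_matrix_def adjacency_matrix_def)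
  have PM: "(P * M) $$ (i, j) = M $$ (f i, j)"
    if M: "M \<in> carrier_mat n n" and i: "i < n" and j: "j < n" for M i j
  proof -
    have "(P * M) $$ (i, j) = (\<Sum>k = 0..<n. (if k = f i then 1 else 0) * M $$ (k, j))"
      using M i j by (simp add: P_def scalar_prod_def)
    also have "\<dots> = (\<Sum>k = 0..<n. if k = f i then M $$ (k, j) else 0)"
      by (rule sum.cong) simp_all
    also have "\<dots> = M $$ (f i, j)" using f(1)[OF i] by simp
    finally show ?thesis .
  qed
  have QM: "(Q * M) $$ (i, j) = M $$ (g i, j)"
    if M: "M \<in> carrier_mat n n" and i: "i < n" and j: "j < n" for M i j
  proof -
    have "(Q * M) $$ (i, j) = (\<Sum>k = 0..<n. (if k = g i then 1 else 0) * M $$ (k, j))"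
      using M i j by (simp add: Q_def scalar_prod_def)
    also have "\<dots> = (\<Sum>k = 0..<n. if k = g i then M $$ (k, j) else 0)"
      by (rule sum.cong) simp_all
    also have "\<dots> = M $$ (g i, j)" using g(1)[OF i] by simp
    finally show ?thesis .
  qed
  have MQ: "(M * Q) $$ (i, j) = M $$ (i, f j)"
    if M: "M \<in> carrier_mat n n" and i: "i < n" and j: "j < n" for M i j
  proof -
    have "(M * Q) $$ (i, j) = (\<Sum>k = 0..<n. M $$ (i, k) * (if j = g k then 1 else 0))"
      using M i j by (simp add: Q_def scalar_prod_def)
    also have "\<dots> = (\<Sum>k = 0..<n. if k = f j then M $$ (i, k) else 0)"
      by (rule sum.cong) (use j fg gf in auto)
    also have "\<dots> = M $$ (i, f j)" using f j by simp
    finally show ?thesis .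
  qed
  have "P * Q = 1\<^sub>m n"
  proof (rule eq_matI)
    fix i j assume "i < dim_row (1\<^sub>m n :: real mat)" "j < dim_col (1\<^sub>m n :: real mat)"
    then have ij: "i < n" "j < n" by simp_all
    have "(P * Q) $$ (i, j) = Q $$ (f i, j)" by (rule PM) (use car ij in auto)
    then show "(P * Q) $$ (i, j) = 1\<^sub>m n $$ (i, j)"
      using ij f(1)[OF ij(1)] gf[OF ij(1)] by (auto simp: Q_def)
  qed (use car in auto)
  moreover have "Q * P = 1\<^sub>m n"
  proof (rule eq_matI)
    fix i j assume "i < dim_row (1\<^sub>m n :: real mat)" "j < dim_col (1\<^sub>m n :: real mat)"
    then have ij: "i < n" "j < n" by simp_all
    have "(Q * P) $$ (i, j) = P $$ (g i, j)" by (rule QM) (use car ij in auto)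
    then show "(Q * P) $$ (i, j) = 1\<^sub>m n $$ (i, j)"
      using ij g(1)[OF ij(1)] fg[OF ij(1)] by (auto simp: P_def)
  qed (use car in auto)
  moreover have "laplacian_matrix G vs = P * L * Q"
  proof (rule eq_matI)
    fix i j assume "i < dim_row (P * L * Q)" "j < dim_col (P * L * Q)"
    then have ij: "i < n" "j < n" using car by auto
    have PL: "P * L \<in> carrier_mat n n" using car by auto
    have "(P * L * Q) $$ (i, j) = L $$ (f i, f j)"
      using MQ[OF PL ij] PM[OF car(3) ij(1) f(1)[OF ij(2)]] by simp
    moreover have "f i = f j \<longleftrightarrow> i = j" using gf ij by metis
    ultimately show "laplacian_matrix G vs $$ (i, j) = (P * L * Q) $$ (i, j)"
      using ij f n
      by (simp add: L_def laplacian_matrix_def degree_matrix_def adjacency_matrix_def)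
  qed (use car in auto)
  ultimately show "similar_mat (laplacian_matrix G vs) (laplacian_matrix G ws)"
    unfolding similar_mat_def similar_mat_wit_def Let_def
    using car by (intro exI[of _ P] exI[of _ Q]) (simp_all flip: L_def)
qed

lemma laplacian_eigenvalues_eq:
  assumes "distinct vs" "set vs = pverts G"
  shows "laplacian_eigenvalues G = proots (char_poly (laplacian_matrix G vs))"
proof -
  have "distinct (SOME vs. distinct vs \<and> set vs = pverts G) \<and>
        set (SOME vs. distinct vs \<and> set vs = pverts G) = pverts G"
    by (rule someI[of "\<lambda>vs. distinct vs \<and> set vs = pverts G" vs]) (use assms in simp)
  with assms show ?thesis
    unfolding laplacian_eigenvalues_def
    by (intro arg_cong[where f = proots] char_poly_laplacian_matrix_enum) auto
qed

end

theory Submission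
  imports Defs
begin

text \<open>If \<open>x\<close> vanishes on a dominating set \<open>S\<close>, every vertex \<open>v\<close> outside \<open>S\<close> contributes
  \<open>(x v - x s)\<^sup>2 = (x v)\<^sup>2\<close> to the Laplacian quadratic form, which is therefore at least \<open>\<parallel>x\<parallel>\<^sup>2\<close>.
  Since a space of dimension greater than \<open>card S\<close> contains such an \<open>x \<noteq> 0\<close>, the graph has at most
  \<open>card S\<close> eigenvalues below 1 (Hedetniemi, Jacobs and Trevisan). The eigenvalues above \<open>n - 1\<close>
  correspond to those below 1 of the complement, except that the eigenvalue 0 of the all-ones
  vector is not counted. The theorem then follows from the bound of Jaeger and Payan: the domination
  numbers of a graph and of its complement have product at most \<open>n\<close>.\<close>

section \<open>Domination in a graph and in its complement\<close>

definition dominating :: "('a \<Rightarrow> 'a \<Rightarrow> bool) \<Rightarrow> 'a set \<Rightarrow> 'a set \<Rightarrow> bool" where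
  "dominating E V D \<longleftrightarrow> D \<subseteq> V \<and> (\<forall>v\<in>V - D. \<exists>d\<in>D. E d v)"

text \<open>Loops affect neither \<open>dominating\<close> nor the quadratic form \<open>dirichlet\<close> below, so
  \<open>\<lambda>x y. \<not> E x y\<close> serves as the edge relation of the complement.

  Partition the vertices into stars centred at a minimum dominating set, maximizing the number of
  vertices adjacent to all others of their class (\<open>full\<close>). Then every class dominates the
  complement: a vertex joined to all of a foreign class could be moved there if it is not full, and
  could replace the centres of both classes if it is.\<close>

lemma dominating_complement_product_le:
  assumes fin: "finite V" and sym: "\<And>x y. E x y \<Longrightarrow> E y x"
    and a: "\<And>D. dominating E V D \<Longrightarrow> a \<le> card D"
    and c: "\<And>D. dominating (\<lambda>x y. \<not> E x y) V D \<Longrightarrow> c \<le> card D"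
  shows "a * c \<le> card V"
proof -
  have "dominating E V V" by (simp add: dominating_def)
  then obtain D where D: "dominating E V D"
    and D_min: "\<And>D'. dominating E V D' \<Longrightarrow> card D \<le> card D'"
    using ex_has_least_nat[of "dominating E V" V card] by blast
  have DV: "D \<subseteq> V" and Ddom: "\<And>v. v \<in> V - D \<Longrightarrow> \<exists>d\<in>D. E d v"
    using D by (auto simp: dominating_def)
  have finD: "finite D" using DV fin finite_subset by blast
  define star where "star f \<longleftrightarrow> (\<forall>d\<in>D. f d = d) \<and> (\<forall>v\<in>V - D. f v \<in> D \<and> E (f v) v)"
    for f :: "'a \<Rightarrow> 'a"
  define full where "full f = {v \<in> V. \<forall>w\<in>V. f w = f v \<longrightarrow> w \<noteq> v \<longrightarrow> E v w}"
    for f :: "'a \<Rightarrow> 'a"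
  have fin_full: "finite (full f)" for f using fin by (simp add: full_def)
  have "\<exists>g. \<forall>v\<in>V - D. g v \<in> D \<and> E (g v) v" using Ddom by (intro bchoice) blast
  then obtain g where "\<forall>v\<in>V - D. g v \<in> D \<and> E (g v) v" by blast
  then have "star (\<lambda>v. if v \<in> D then v else g v)" by (simp add: star_def)
  moreover have "card (full f) < Suc (card V)" for f
    by (auto simp: full_def less_Suc_eq_le intro: card_mono[OF fin])
  ultimately obtain f where f: "star f"
    and f_max: "\<And>f'. star f' \<Longrightarrow> card (full f') \<le> card (full f)"
    using Lattices_Big.ex_has_greatest_nat[of star _ "\<lambda>f. card (full f)"] by blast
  have fD: "f v \<in> D" if "v \<in> V" for v using f that by (cases "v \<in> D") (auto simp: star_def)
  have fid: "f d = d" if "d \<in> D" for d using f that by (simp add: star_def)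
  have fE: "E (f v) v" if "v \<in> V" "v \<notin> D" for v using f that by (simp add: star_def)
  have class_dom: "dominating (\<lambda>x y. \<not> E x y) V {v\<in>V. f v = d}" if d: "d \<in> D" for d
  proof (rule ccontr)
    assume "\<not> ?thesis"
    then obtain v where v: "v \<in> V" "f v \<noteq> d" and all: "\<And>w. w \<in> V \<Longrightarrow> f w = d \<Longrightarrow> E w v"
      by (auto simp: dominating_def)
    show False
    proof (cases "v \<in> full f")
      case True
      \<comment> \<open>The vertex \<open>v\<close> takes over the class of \<open>d\<close> by
        \<open>all\<close> and its own class because it is full; all other classes keep their
        centres. As \<open>f v\<close> differs from \<open>d\<close>, one vertex replaces
        two.\<close>
      let ?D' = "insert v (D - {f v, d})"
      have "\<exists>s\<in>?D'. E s w" if w: "w \<in> V" "w \<notin> ?D'" for w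
      proof (cases "f w = d \<or> f w = f v")
        case True
        then have "E v w" using all sym \<open>v \<in> full f\<close> w unfolding full_def by auto
        then show ?thesis by blast
      next
        case False
        then have "w \<notin> D" using w fid by auto
        then show ?thesis using False w fE fD by blast
      qed
      then have "dominating E V ?D'" using DV v by (auto simp: dominating_def)
      then have "card D \<le> card ?D'" by (rule D_min)
      also have "\<dots> \<le> Suc (card (D - {f v, d}))" by (rule card_insert_le_m1) auto
      also have "card (D - {f v, d}) = card D - 2"
        using v d fD finD by (subst card_Diff_subset) auto
      finally have "card D \<le> Suc (card D - 2)" .
      \<comment> \<open>Two distinct centres give \<open>card D \<ge> 2\<close>, so the truncated
        subtraction is exact.\<close>
      moreover have "card {f v, d} \<le> card D" using fD v d finD by (intro card_mono) auto
      ultimately show False using v by simp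
    next
      case False
      \<comment> \<open>A centre is adjacent to all others of its class, hence full. So
        \<open>v\<close> is not a centre and may change class.\<close>
      have vD: "v \<notin> D"
      proof
        assume "v \<in> D"
        moreover from this have "E v w" if "w \<in> V" "f w = f v" "w \<noteq> v" for w
          using that fid fE by metis
        ultimately show False using False v by (auto simp: full_def)
      qed
      let ?f' = "f(v := d)"
      have "E d v" using all[of d] fid d DV by blast
      then have "star ?f'" using f d vD by (auto simp: star_def)
      then have "card (full ?f') \<le> card (full f)" by (rule f_max)
      \<comment> \<open>In its new class \<open>v\<close> is full by \<open>all\<close>. Full
        vertices stay full: the old class only loses \<open>v\<close>, and everything in the new one
        is adjacent to \<open>v\<close>. This contradicts the maximality of
        \<open>f\<close>.\<close>
      moreover have "insert v (full f) \<subseteq> full ?f'"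
        using v all sym by (auto simp: full_def)
      then have "card (insert v (full f)) \<le> card (full ?f')" by (intro card_mono fin_full)
      ultimately show False using False fin_full by simp
    qed
  qed
  \<comment> \<open>There are at least \<open>a\<close> classes; they are disjoint, and each has at
    least \<open>c\<close> vertices by \<open>class_dom\<close>.\<close>
  have "a * c \<le> card D * c" using a[OF D] by simp
  also have "\<dots> \<le> (\<Sum>d\<in>D. card {v\<in>V. f v = d})"
    using sum_mono[of D "\<lambda>_. c", OF c[OF class_dom]] by simp
  also have "\<dots> = card (\<Union>d\<in>D. {v\<in>V. f v = d})"
    using finD fin by (subst card_UN_disjoint) auto
  also have "\<dots> \<le> card V" by (intro card_mono fin) auto
  finally show ?thesis .
qed

section \<open>Linear systems and orthonormal eigenvectors of symmetric matrices\<close>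

text \<open>Padding the coefficients with zero rows gives a singular square matrix; \<open>y\<close>
  is a nonzero kernel vector.\<close>

lemma underdetermined_system_nontrivial:
  fixes f :: "'b \<Rightarrow> nat \<Rightarrow> 'c :: field"
  assumes "finite S" "card S < k"
  shows "\<exists>y. (\<exists>l<k. y l \<noteq> 0) \<and> (\<forall>s\<in>S. (\<Sum>l<k. f s l * y l) = 0)"
proof -
  obtain g where g: "bij_betw g {0..<card S} S"
    using ex_bij_betw_nat_finite[OF assms(1)] by blast
  define M where "M = mat k k (\<lambda>(i, j). if i < card S then f (g i) j else 0)"
  have M: "M \<in> carrier_mat k k" by (simp add: M_def)
  have "M = mat\<^sub>r k k (\<lambda>i. if i = k - 1 then 0\<^sub>v k else row M i)"
    using assms(2) by (intro eq_matI) (auto simp: M_def)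
  also have "det \<dots> = 0" using assms(2) M by (intro det_row_0) auto
  finally obtain v where v: "v \<in> carrier_vec k" "v \<noteq> 0\<^sub>v k" "M *\<^sub>v v = 0\<^sub>v k"
    using det_0_iff_vec_prod_zero_field[OF M] by blast
  have "\<exists>l<k. v $ l \<noteq> 0" using v by (metis carrier_vecD eq_vecI index_zero_vec)
  moreover have "(\<Sum>l<k. f s l * v $ l) = 0" if s: "s \<in> S" for s
  proof -
    obtain i where i: "i < card S" "s = g i" using g s unfolding bij_betw_def by force
    have "(M *\<^sub>v v) $ i = (\<Sum>l<k. f s l * v $ l)"
      using v(1) i assms by (simp add: M_def scalar_prod_def lessThan_atLeast0)
    then show ?thesis using v i assms by simp
  qed
  ultimately show ?thesis by blast
qed

text \<open>\<open>H\<close> is the reflection I - c w w^T with w = v - e_0, which interchanges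
  \<open>v\<close> and the first unit vector e_0. As \<open>v\<close> is a unit vector, |w|^2 = 2 (1
  - v_0), so the usual factor 2 / |w|^2 is \<open>c\<close>.\<close>

lemma householder:
  fixes v :: "real vec"
  assumes v: "v \<in> carrier_vec n" and n: "0 < n" and unit: "v \<bullet> v = 1"
  shows "\<exists>H\<in>carrier_mat n n. transpose_mat H = H \<and> H * H = 1\<^sub>m n \<and> col H 0 = v"
proof -
  \<comment> \<open>If \<open>v $ 0 = 1\<close>, then \<open>v\<close> is the first unit vector, \<open>c = 1 / 0 = 0\<close> and \<open>H\<close> is the identity.\<close>
  define c where "c = 1 / (1 - v $ 0)"
  define w where "w i = v $ i - (if i = 0 then 1 else 0)" for i
  define H where "H = mat n n (\<lambda>(i, j). (if i = j then 1 else 0) - c * w i * w j)"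
  have H: "H \<in> carrier_mat n n" by (simp add: H_def)
  have vv: "(\<Sum>k<n. v $ k * v $ k) = 1"
    using unit v by (simp add: scalar_prod_def lessThan_atLeast0)
  have "(\<Sum>k<n. w k * w k) =
      (\<Sum>k<n. v $ k * v $ k + (if k = 0 then 1 - 2 * v $ 0 else 0))"
    by (intro sum.cong) (auto simp: w_def algebra_simps)
  also have "\<dots> = 2 - 2 * v $ 0" using n vv by (simp add: sum.distrib)
  finally have ww: "(\<Sum>k<n. w k * w k) = 2 - 2 * v $ 0" .
  have cww: "c * c * (\<Sum>k<n. w k * w k) = 2 * c"
  proof (cases "v $ 0 = 1")
    case False
    then have "c * (2 - 2 * v $ 0) = 2" by (simp add: c_def field_simps)
    then show ?thesis by (simp add: ww mult.assoc)
  qed (simp add: c_def)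
  have "(H * H) $$ (i, j) = 1\<^sub>m n $$ (i, j)" if ij: "i < n" "j < n" for i j
  proof -
    have "(H * H) $$ (i, j) = (\<Sum>k<n. ((if i = k then 1 else 0) - c * w i * w k) *
        ((if k = j then 1 else 0) - c * w k * w j))"
      using ij by (simp add: H_def scalar_prod_def lessThan_atLeast0)
    also have "\<dots> = (\<Sum>k<n. (if k = i then (if i = j then 1 else 0) - c * w i * w j else 0)
        - (if k = j then c * w i * w j else 0) + w i * w j * (c * c * (w k * w k)))"
      by (intro sum.cong) (auto simp: algebra_simps)
    also have "\<dots> = (if i = j then 1 else 0) - 2 * c * w i * w j
        + w i * w j * (c * c * (\<Sum>k<n. w k * w k))"
      using ij by (simp add: sum.distrib sum_subtractf flip: sum_distrib_left)
    also have "\<dots> = (if i = j then 1 else 0)" unfolding cww by simp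
    finally show ?thesis using ij by simp
  qed
  then have "H * H = 1\<^sub>m n" using H by (intro eq_matI) auto
  moreover have "transpose_mat H = H" by (intro eq_matI) (auto simp: H_def)
  moreover have "col H 0 = v"
  proof (rule eq_vecI)
    fix i assume i: "i < dim_vec v"
    have "(if i = 0 then 1 else 0) - c * w i * w 0 = v $ i"
    proof (cases "v $ 0 = 1")
      case True
      have "(\<Sum>k<n. w k * w k) = 0" using ww True by simp
      then have "w i * w i = 0"
        using i v by (subst (asm) sum_nonneg_eq_0_iff) auto
      then show ?thesis by (auto simp: w_def split: if_splits)
    next
      case False
      have "c * w 0 = -1" using False by (simp add: c_def w_def field_simps)
      then have "c * w 0 * w i = - w i" by simp
      then show ?thesis by (simp add: w_def mult_ac)
    qed
    then show "col H 0 $ i = v $ i" using i v n by (simp add: H_def)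
  qed (use H v in auto)
  ultimately show ?thesis using H by blast
qed

lemma symmetric_unit_eigenvector:
  fixes A :: "real mat"
  assumes A: "A \<in> carrier_mat n n" and e: "e \<in># proots (char_poly A)"
  shows "\<exists>v\<in>carrier_vec n. v \<bullet> v = 1 \<and> A *\<^sub>v v = e \<cdot>\<^sub>v v"
proof -
  have "char_poly A \<noteq> 0" using e by auto
  then have "poly (char_poly A) e = 0" using e by simp
  then have "eigenvalue A e" using eigenvalue_root_char_poly[OF A] by simp
  then obtain u where u: "u \<in> carrier_vec n" "u \<noteq> 0\<^sub>v n" "A *\<^sub>v u = e \<cdot>\<^sub>v u"
    using A by (auto simp: eigenvalue_def eigenvector_def)
  obtain i where i: "i < n" "u $ i \<noteq> 0"
    using u(1,2) by (metis carrier_vecD eq_vecI index_zero_vec)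
  have "0 < (\<Sum>k\<in>{0..<n}. u $ k * u $ k)"
    by (rule sum_pos2[of _ i]) (use i in \<open>auto simp: zero_less_mult_iff\<close>)
  then have pos: "u \<bullet> u > 0" using u by (simp add: scalar_prod_def)
  define r where "r = 1 / sqrt (u \<bullet> u)"
  have "r * r * (u \<bullet> u) = 1" using pos by (simp add: r_def)
  then have "(r \<cdot>\<^sub>v u) \<bullet> (r \<cdot>\<^sub>v u) = 1" using u by simp
  moreover have "A *\<^sub>v (r \<cdot>\<^sub>v u) = e \<cdot>\<^sub>v (r \<cdot>\<^sub>v u)"
    using mult_mat_vec[OF A u(1)] u by (simp add: smult_smult_assoc mult.commute)
  ultimately show ?thesis using u by (intro bexI[of _ "r \<cdot>\<^sub>v u"]) auto
qed

text \<open>Conjugation by a reflection that maps the first unit vector to a unit eigenvector splits off a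
  1 by 1 block.\<close>

lemma symmetric_orthonormal_eigenvectors:
  fixes A :: "real mat"
  assumes "A \<in> carrier_mat n n" "transpose_mat A = A" "mset es \<subseteq># proots (char_poly A)"
  shows "\<exists>U\<in>carrier_mat n (length es). transpose_mat U * U = 1\<^sub>m (length es) \<and>
    A * U = U * mat_diag (length es) ((!) es)"
  using assms
\<comment> \<open>Each step uses up one listed root and passes to a symmetric matrix of one
  dimension less, hence \<open>n\<close> and \<open>A\<close> vary.\<close>
proof (induction es arbitrary: n A)
  case Nil
  show ?case by (rule bexI[of _ "0\<^sub>m n 0"], intro conjI eq_matI)
      (use Nil in \<open>auto simp: mat_diag_def\<close>)
next
  case (Cons e es)
  note A = \<open>A \<in> carrier_mat n n\<close>
  let ?k = "length es"
  have "e \<in># proots (char_poly A)" using mset_subset_eqD[OF Cons.prems(3)] by simp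
  then obtain v where v: "v \<in> carrier_vec n" and vv: "v \<bullet> v = 1" and Av: "A *\<^sub>v v = e \<cdot>\<^sub>v v"
    using symmetric_unit_eigenvector[OF A] by blast
  have "n \<noteq> 0"
  proof
    assume "n = 0"
    then show False using v vv by (simp add: scalar_prod_def)
  qed
  then obtain m where n: "n = Suc m" by (cases n) auto
  obtain H where H: "H \<in> carrier_mat n n" and HT: "transpose_mat H = H"
    and HH: "H * H = 1\<^sub>m n" and H0: "col H 0 = v"
    using householder[OF v _ vv] n by auto
  define B where "B = H * (A * H)"
  have B: "B \<in> carrier_mat n n" using A H by (simp add: B_def)
  have AH: "A * H = H * B"
    unfolding B_def using A H HH by (subst assoc_mult_mat[symmetric, of _ n n _ n]) auto
  have HB: "H * B * H = A"
    unfolding AH[symmetric] using A H HH by (subst assoc_mult_mat[of _ n n _ n _ n]) auto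
  have BT: "transpose_mat B = B"
  proof -
    have "transpose_mat B = transpose_mat (A * H) * transpose_mat H"
      unfolding B_def using A H by (intro transpose_mult) auto
    also have "transpose_mat (A * H) = H * A"
      using A H HT Cons.prems(2) by (subst transpose_mult[of _ n n _ n]) auto
    also have "H * A * transpose_mat H = B"
      unfolding B_def HT using A H by (intro assoc_mult_mat) auto
    finally show ?thesis .
  qed
  \<comment> \<open>The involution \<open>H\<close> exchanges the first unit vector and
    \<open>v\<close>, so that unit vector is an eigenvector of \<open>B\<close> for
    \<open>e\<close>. By symmetry the first row is cleared too.\<close>
  have "col B 0 = e \<cdot>\<^sub>v unit_vec n 0"
  proof -
    have "col B 0 = H *\<^sub>v col (A * H) 0"
      unfolding B_def using A H n by (intro col_mult2) auto
    also have "col (A * H) 0 = A *\<^sub>v col H 0"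
      using A H n by (intro col_mult2) auto
    also have "H *\<^sub>v \<dots> = e \<cdot>\<^sub>v (H *\<^sub>v v)"
      unfolding H0 Av using mult_mat_vec[OF H v] .
    also have "H *\<^sub>v v = col (H * H) 0"
      using H n by (subst col_mult2[of _ n n _ n]) (auto simp: H0)
    also have "\<dots> = unit_vec n 0" unfolding HH using n by simp
    finally show ?thesis .
  qed
  then have Bi0: "B $$ (i, 0) = (if i = 0 then e else 0)" if "i < n" for i
    using that B n by (metis (no_types, lifting) index_col carrier_matD index_smult_vec(1)
      index_unit_vec(1) index_unit_vec(3) mult_cancel_left1 mult_zero_right zero_less_Suc)
  have B0i: "B $$ (0, i) = (if i = 0 then e else 0)" if "i < n" for i
    using Bi0[OF that] BT B n that by (metis carrier_matD index_transpose_mat(1) zero_less_Suc)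
  define C where "C = mat m m (\<lambda>(i, j). B $$ (Suc i, Suc j))"
  have C: "C \<in> carrier_mat m m" by (simp add: C_def)
  define E where "E = mat 1 1 (\<lambda>_. e)"
  have E: "E \<in> carrier_mat 1 1" by (simp add: E_def)
  have Bblock: "B = four_block_mat E (0\<^sub>m 1 m) (0\<^sub>m m 1) C"
    using B n by (intro eq_matI) (auto simp: C_def E_def Bi0 B0i)
  have CT: "transpose_mat C = C"
  proof (rule eq_matI)
    fix i j assume "i < dim_row C" "j < dim_col C"
    then have ij: "i < m" "j < m" by (auto simp: C_def)
    have "B $$ (Suc j, Suc i) = transpose_mat B $$ (Suc i, Suc j)" using B ij n by simp
    then show "transpose_mat C $$ (i, j) = C $$ (i, j)" using ij BT by (simp add: C_def)
  qed (auto simp: C_def)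
  have "similar_mat A B"
    unfolding similar_mat_def similar_mat_wit_def Let_def
    using A B H HH HB by (intro exI[of _ H]) auto
  then have "char_poly A = char_poly E * char_poly C"
    unfolding Bblock using char_poly_four_block_zeros_col[OF E _ C, of "0\<^sub>m 1 m"]
    by (simp add: char_poly_similar)
  also have "char_poly E = [:- e, 1:]"
    by (simp add: char_poly_defs det_single E_def)
  finally have cp: "char_poly A = [:- e, 1:] * char_poly C" .
  have "char_poly A \<noteq> 0" using Cons.prems(3) by auto
  then have "char_poly C \<noteq> 0" unfolding cp by auto
  \<comment> \<open>Splitting off the block removes exactly one copy of \<open>e\<close>, so
    multiplicities are respected.\<close>
  then have "proots (char_poly A) = add_mset e (proots (char_poly C))"
    unfolding cp by (subst proots_mult) (auto simp del: mult_pCons_left)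
  then have "mset es \<subseteq># proots (char_poly C)" using Cons.prems(3) by simp
  from Cons.IH[OF C CT this] obtain U where U: "U \<in> carrier_mat m ?k"
    and UU: "transpose_mat U * U = 1\<^sub>m ?k" and CU: "C * U = U * mat_diag ?k ((!) es)"
    by blast
  \<comment> \<open>Eigenvectors of \<open>B\<close>: the first unit vector, and those of
    \<open>C\<close> preceded by a zero entry. Multiplication by \<open>H\<close> carries them back
    to \<open>A\<close>.\<close>
  define W where "W = four_block_mat (1\<^sub>m 1) (0\<^sub>m 1 ?k) (0\<^sub>m m 1) U"
  define D where "D = mat_diag (Suc ?k) ((!) (e # es))"
  have W: "W \<in> carrier_mat n (Suc ?k)" using four_block_carrier_mat[OF one_carrier_mat U, of 1]
    by (simp add: W_def n)
  have D: "D \<in> carrier_mat (Suc ?k) (Suc ?k)" by (simp add: D_def)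
  have Dblock: "D = four_block_mat E (0\<^sub>m 1 ?k) (0\<^sub>m ?k 1) (mat_diag ?k ((!) es))"
    by (intro eq_matI) (auto simp: D_def E_def mat_diag_def nth_Cons split: nat.splits)
  have "transpose_mat W = four_block_mat (1\<^sub>m 1) (0\<^sub>m 1 m) (0\<^sub>m ?k 1) (transpose_mat U)"
    unfolding W_def using U by (subst transpose_four_block_mat[of _ 1 1 _ ?k _ m]) auto
  then have "transpose_mat W * W =
      four_block_mat (1\<^sub>m 1) (0\<^sub>m 1 ?k) (0\<^sub>m ?k 1) (transpose_mat U * U)"
    unfolding W_def using U
    by (simp, subst mult_four_block_mat[of _ 1 1 _ m _ ?k _ _ 1 _ ?k]) auto
  then have WW: "transpose_mat W * W = 1\<^sub>m (Suc ?k)" by (simp add: UU)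
  have dk: "mat_diag ?k ((!) es) \<in> carrier_mat ?k ?k" by simp
  have "B * W = four_block_mat E (0\<^sub>m 1 ?k) (0\<^sub>m m 1) (C * U)"
    unfolding Bblock W_def using U C E
    by (subst mult_four_block_mat[of _ 1 1 _ m _ m _ _ 1 _ ?k]) auto
  also have "\<dots> = W * D"
    unfolding Dblock W_def CU using U C E dk
    by (subst mult_four_block_mat[of _ 1 1 _ ?k _ m _ _ 1 _ ?k])
       (auto simp: left_mult_zero_mat[OF dk])
  finally have BW: "B * W = W * D" .
  have HW: "H * W \<in> carrier_mat n (Suc ?k)" using H W by simp
  have "transpose_mat (H * W) * (H * W) = (transpose_mat W * H) * (H * W)"
    using transpose_mult[OF H W] HT by simp
  also have "\<dots> = transpose_mat W * (H * (H * W))"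
    using H W by (intro assoc_mult_mat[of _ _ n]) auto
  also have "H * (H * W) = W"
    using H W HH by (subst assoc_mult_mat[symmetric, of _ n n]) auto
  finally have "transpose_mat (H * W) * (H * W) = 1\<^sub>m (Suc ?k)" using WW by simp
  moreover have "A * (H * W) = (H * W) * D"
  proof -
    have "A * (H * W) = H * B * W" using A H W by (simp add: AH flip: assoc_mult_mat)
    also have "\<dots> = H * (W * D)" using H W B by (simp add: BW assoc_mult_mat[of _ n n])
    also have "\<dots> = (H * W) * D" using H W D by (intro assoc_mult_mat[symmetric]) auto
    finally show ?thesis .
  qed
  ultimately show ?case using HW unfolding D_def by (intro bexI[of _ "H * W"]) auto
qed

section \<open>Coordinates with respect to orthonormal eigenvectors\<close>

text \<open>The matrix equations A U = U D and U^T U = 1 in entrywise form, because the graph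
  arguments evaluate eigenvectors at vertices.\<close>

definition eigenfamily ::
    "real mat \<Rightarrow> nat \<Rightarrow> nat \<Rightarrow> (nat \<Rightarrow> nat \<Rightarrow> real) \<Rightarrow> (nat \<Rightarrow> real) \<Rightarrow> bool" where
  "eigenfamily A n k u d \<longleftrightarrow>
     (\<forall>l<k. \<forall>i<n. (\<Sum>j<n. A $$ (i, j) * u l j) = d l * u l i) \<and>
     (\<forall>l<k. \<forall>l'<k. (\<Sum>i<n. u l i * u l' i) = (if l = l' then 1 else 0))"

lemma symmetric_eigenfamily:
  fixes A :: "real mat"
  assumes A: "A \<in> carrier_mat n n" "transpose_mat A = A"
    and k: "k = size {#x \<in># proots (char_poly A). x \<in> I#}"
  obtains u d where
    "\<And>l. l < k \<Longrightarrow> d l \<in> I"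
    "eigenfamily A n k u d"
proof -
  obtain es where es: "mset es = {#x \<in># proots (char_poly A). x \<in> I#}"
    using ex_mset by blast
  have len: "length es = k" using es k by (metis size_mset)
  have "mset es \<subseteq># proots (char_poly A)" by (simp add: es)
  then obtain U where U: "U \<in> carrier_mat n k"
    and UU: "transpose_mat U * U = 1\<^sub>m k" and AU: "A * U = U * mat_diag k ((!) es)"
    using symmetric_orthonormal_eigenvectors[OF A] len by blast
  show thesis
  proof (rule that[of "(!) es" "\<lambda>l i. U $$ (i, l)"])
    fix l assume "l < k"
    then have "es ! l \<in># mset es" using len by simp
    then show "es ! l \<in> I" unfolding es by simp
  next
    have "(\<Sum>j<n. A $$ (i, j) * U $$ (j, l)) = es ! l * U $$ (i, l)" if "l < k" "i < n" for l i
    proof -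
      have "(\<Sum>j<n. A $$ (i, j) * U $$ (j, l)) = (A * U) $$ (i, l)"
        using that A U by (simp add: scalar_prod_def lessThan_atLeast0)
      then show ?thesis using that U by (simp add: AU mat_diag_mult_right[OF U])
    qed
    moreover have "(\<Sum>i<n. U $$ (i, l) * U $$ (i, l')) = (if l = l' then 1 else 0)"
      if "l < k" "l' < k" for l l'
    proof -
      have "(\<Sum>i<n. U $$ (i, l) * U $$ (i, l')) = (transpose_mat U * U) $$ (l, l')"
        using that U by (simp add: scalar_prod_def lessThan_atLeast0)
      then show ?thesis using that by (simp add: UU)
    qed
    ultimately show "eigenfamily A n k (\<lambda>l i. U $$ (i, l)) ((!) es)"
      by (simp add: eigenfamily_def)
  qed
qed

text \<open>Parseval's identity: orthonormality makes the map from coefficients to vectors an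
  isometry.\<close>

lemma eigenfamily_combination_product:
  assumes "eigenfamily A n k u d"
  shows "(\<Sum>i<n. (\<Sum>l<k. p l * u l i) * (\<Sum>l<k. q l * u l i)) = (\<Sum>l<k. p l * q l)"
proof -
  have "(\<Sum>i<n. (\<Sum>l<k. p l * u l i) * (\<Sum>l<k. q l * u l i)) =
      (\<Sum>i<n. \<Sum>l<k. \<Sum>l'<k. p l * q l' * (u l i * u l' i))"
    by (simp add: sum_product mult_ac)
  also have "\<dots> = (\<Sum>l<k. \<Sum>i<n. \<Sum>l'<k. p l * q l' * (u l i * u l' i))"
    by (rule sum.swap)
  also have "\<dots> = (\<Sum>l<k. \<Sum>l'<k. \<Sum>i<n. p l * q l' * (u l i * u l' i))"
    by (rule sum.cong[OF refl], rule sum.swap)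
  also have "\<dots> = (\<Sum>l<k. \<Sum>l'<k. if l = l' then p l * q l' else 0)"
    by (intro sum.cong refl) (simp add: assms[unfolded eigenfamily_def] flip: sum_distrib_left)
  also have "\<dots> = (\<Sum>l<k. p l * q l)" by simp
  finally show ?thesis .
qed

section \<open>The Laplacian quadratic form\<close>

text \<open>The sum runs over ordered pairs, so for symmetric \<open>E\<close> it is twice the usual
  Laplacian form; hence the factors 2 below.\<close>

definition dirichlet :: "(nat \<Rightarrow> nat \<Rightarrow> bool) \<Rightarrow> nat \<Rightarrow> (nat \<Rightarrow> real) \<Rightarrow> real" where
  "dirichlet E n x = (\<Sum>i<n. \<Sum>j<n. of_bool (E i j) * (x i - x j)\<^sup>2)"

text \<open>Writing (x_i - x_j)^2 as x_i (x_i - x_j) + x_j (x_j - x_i) gives two sums that are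
  exchanged by swapping i and j.\<close>

lemma dirichlet_eq_laplacian_form:
  assumes sym: "\<And>i j. E i j \<Longrightarrow> E j i"
  shows "dirichlet E n x = 2 * (\<Sum>i<n. x i * (\<Sum>j<n. of_bool (E i j) * (x i - x j)))"
proof -
  have sym': "E i j = E j i" for i j using sym by blast
  let ?s = "\<Sum>i<n. \<Sum>j<n. of_bool (E i j) * (x i * (x i - x j))"
  have "dirichlet E n x = ?s + (\<Sum>i<n. \<Sum>j<n. of_bool (E i j) * (x j * (x j - x i)))"
    by (simp add: dirichlet_def power2_eq_square algebra_simps flip: sum.distrib)
  also have "(\<Sum>i<n. \<Sum>j<n. of_bool (E i j) * (x j * (x j - x i))) = ?s"
    by (subst sum.swap) (simp add: sym')
  also have "?s = (\<Sum>i<n. x i * (\<Sum>j<n. of_bool (E i j) * (x i - x j)))"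
    by (simp only: sum_distrib_left mult.left_commute)
  finally show ?thesis by simp
qed

text \<open>A relation and its negation cover each ordered pair once, so the two forms add up to
  that of the complete graph.\<close>

lemma dirichlet_complement:
  "dirichlet E n x + dirichlet (\<lambda>i j. \<not> E i j) n x =
    2 * (real n * (\<Sum>i<n. (x i)\<^sup>2) - (\<Sum>i<n. x i)\<^sup>2)"
proof -
  have "dirichlet E n x + dirichlet (\<lambda>i j. \<not> E i j) n x = (\<Sum>i<n. \<Sum>j<n. (x i - x j)\<^sup>2)"
    unfolding dirichlet_def sum.distrib[symmetric] by (intro sum.cong refl) auto
  also have "\<dots> = (\<Sum>i<n. \<Sum>j<n. (x i)\<^sup>2 + (x j)\<^sup>2 - 2 * (x i * x j))"
    by (intro sum.cong refl) (simp add: power2_diff)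
  also have "\<dots> = 2 * (real n * (\<Sum>i<n. (x i)\<^sup>2)) - 2 * (\<Sum>i<n. \<Sum>j<n. x i * x j)"
    by (simp add: sum.distrib sum_subtractf sum_distrib_left)
  also have "(\<Sum>i<n. \<Sum>j<n. x i * x j) = (\<Sum>i<n. x i)\<^sup>2"
    by (simp add: power2_eq_square sum_product)
  finally show ?thesis by (simp add: algebra_simps)
qed

lemma dirichlet_shift: "dirichlet E n (\<lambda>i. x i + c) = dirichlet E n x"
  by (simp add: dirichlet_def)

text \<open>Cut the double sum into four blocks along \<open>S\<close>. The two mixed blocks are
  equal by symmetry, and each is at least the squared norm of \<open>x\<close>; the other two are
  nonnegative.\<close>

lemma dirichlet_ge_of_dominating:
  assumes sym: "\<And>i j. E i j \<Longrightarrow> E j i"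
    and S: "dominating E {..<n} S" and x: "\<And>s. s \<in> S \<Longrightarrow> x s = 0"
  shows "2 * (\<Sum>i<n. (x i)\<^sup>2) \<le> dirichlet E n x"
proof -
  let ?T = "{..<n} - S" and ?t = "\<lambda>i j. of_bool (E i j) * (x i - x j)\<^sup>2"
  have SV: "S \<subseteq> {..<n}" and dom: "\<And>v. v \<in> ?T \<Longrightarrow> \<exists>d\<in>S. E d v"
    using S by (auto simp: dominating_def)
  have finS: "finite S" using SV finite_subset by blast
  have sym': "E i j = E j i" for i j using sym by blast
  have split: "(\<Sum>i<n. f i) = (\<Sum>i\<in>?T. f i) + (\<Sum>i\<in>S. f i)" for f :: "nat \<Rightarrow> real"
    using SV by (intro sum.subset_diff) auto
  have "(\<Sum>i\<in>?T. (x i)\<^sup>2) \<le> (\<Sum>i\<in>?T. \<Sum>j\<in>S. ?t i j)"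
  proof (rule sum_mono)
    fix i assume i: "i \<in> ?T"
    then obtain d where d: "d \<in> S" "E d i" using dom by blast
    then have "(x i)\<^sup>2 = ?t i d" using x sym by simp
    also have "\<dots> \<le> (\<Sum>j\<in>S. ?t i j)" using d finS by (intro member_le_sum) auto
    finally show "(x i)\<^sup>2 \<le> (\<Sum>j\<in>S. ?t i j)" .
  qed
  moreover have "(\<Sum>i\<in>S. \<Sum>j\<in>?T. ?t i j) = (\<Sum>i\<in>?T. \<Sum>j\<in>S. ?t i j)"
    by (subst sum.swap) (simp add: sym' power2_commute)
  moreover have "0 \<le> (\<Sum>i\<in>?T. \<Sum>j\<in>?T. ?t i j)" "0 \<le> (\<Sum>i\<in>S. \<Sum>j\<in>S. ?t i j)"
    by (intro sum_nonneg; simp)+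
  moreover have "(\<Sum>i<n. (x i)\<^sup>2) = (\<Sum>i\<in>?T. (x i)\<^sup>2)" by (simp add: split x)
  ultimately show ?thesis unfolding dirichlet_def split by (simp add: sum.distrib)
qed

section \<open>Eigenvalue counts bounded by dominating sets\<close>

locale laplacian =
  fixes E :: "nat \<Rightarrow> nat \<Rightarrow> bool" and n :: nat and A :: "real mat"
  assumes sym: "E i j \<Longrightarrow> E j i"
    and A: "A \<in> carrier_mat n n" "transpose_mat A = A"
    and mult: "i < n \<Longrightarrow> (\<Sum>j<n. A $$ (i, j) * x j) = (\<Sum>j<n. of_bool (E i j) * (x i - x j))"
begin

text \<open>Eigenvector coordinates diagonalize the form: the Laplacian multiplies coefficient l by
  \<open>d l\<close>, and Parseval's identity does the rest.\<close>

lemma dirichlet_combination: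
  assumes u: "eigenfamily A n k u d"
  shows "dirichlet E n (\<lambda>i. \<Sum>l<k. y l * u l i) = 2 * (\<Sum>l<k. d l * (y l)\<^sup>2)"
proof -
  let ?x = "\<lambda>i. \<Sum>l<k. y l * u l i"
  have "(\<Sum>j<n. of_bool (E i j) * (?x i - ?x j)) = (\<Sum>l<k. d l * y l * u l i)" if "i < n" for i
  proof -
    have "(\<Sum>j<n. of_bool (E i j) * (?x i - ?x j)) = (\<Sum>j<n. A $$ (i, j) * ?x j)"
      by (rule mult[OF that, symmetric])
    also have "\<dots> = (\<Sum>l<k. y l * (\<Sum>j<n. A $$ (i, j) * u l j))"
      unfolding sum_distrib_left by (subst sum.swap) (simp add: mult_ac)
    also have "\<dots> = (\<Sum>l<k. d l * y l * u l i)"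
      by (intro sum.cong refl) (simp add: u[unfolded eigenfamily_def] that)
    finally show ?thesis .
  qed
  then have "dirichlet E n ?x = 2 * (\<Sum>i<n. ?x i * (\<Sum>l<k. d l * y l * u l i))"
    by (subst dirichlet_eq_laplacian_form) (auto intro: sym)
  also have "\<dots> = 2 * (\<Sum>l<k. y l * (d l * y l))"
    by (subst eigenfamily_combination_product[OF u]) auto
  finally show ?thesis by (simp add: power2_eq_square mult_ac)
qed

text \<open>The rows of a Laplacian sum to 0, hence by symmetry so do the columns. The entries of
  \<open>A\<close> applied to \<open>u\<close> therefore sum to 0, and also to \<open>d\<close>
  times the sum of \<open>u\<close>.\<close>

lemma eigenvector_sum_zero:
  assumes "\<And>i. i < n \<Longrightarrow> (\<Sum>j<n. A $$ (i, j) * u j) = d * u i" "d \<noteq> 0"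
  shows "(\<Sum>i<n. u i) = 0"
proof -
  have A_sym: "A $$ (i, j) = A $$ (j, i)" if "i < n" "j < n" for i j
    using A that by (metis carrier_matD index_transpose_mat(1))
  have "d * (\<Sum>i<n. u i) = (\<Sum>i<n. \<Sum>j<n. A $$ (i, j) * u j)"
    using assms(1) by (simp add: sum_distrib_left)
  also have "\<dots> = (\<Sum>j<n. u j * (\<Sum>i<n. A $$ (i, j) * 1))"
    by (subst sum.swap) (simp add: sum_distrib_left mult_ac)
  also have "\<dots> = (\<Sum>j<n. u j * (\<Sum>i<n. A $$ (j, i) * 1))"
    using A_sym by (intro sum.cong refl arg_cong2[where f = "(*)"]) auto
  also have "\<dots> = 0" using mult[of _ "\<lambda>_. 1"] by simp
  finally show ?thesis using assms(2) by simp
qed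

text \<open>Otherwise some nonzero combination of the eigenvectors vanishes on \<open>S\<close>.
  Twice its squared norm is then a lower bound for its form by domination, but a strict upper bound
  by the eigenvalues.\<close>

lemma eigenvalues_below_one_le:
  assumes S: "dominating E {..<n} S"
  shows "size {#x \<in># proots (char_poly A). x \<in> {0..<1}#} \<le> card S"
proof (rule ccontr)
  define k where "k = size {#x \<in># proots (char_poly A). x \<in> {0..<1}#}"
  assume "\<not> ?thesis"
  then have "card S < k" by (simp add: k_def)
  obtain u d where d: "\<And>l. l < k \<Longrightarrow> d l \<in> {0..<1}"
    and u: "eigenfamily A n k u d"
    using symmetric_eigenfamily[OF A k_def] by blast
  have "finite S" using S finite_subset by (auto simp: dominating_def)
  then obtain y where y: "\<exists>l<k. y l \<noteq> 0" and y0: "\<forall>s\<in>S. (\<Sum>l<k. u l s * y l) = 0"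
    using underdetermined_system_nontrivial[OF _ \<open>card S < k\<close>, of "\<lambda>s l. u l s"] by blast
  let ?x = "\<lambda>i. \<Sum>l<k. y l * u l i"
  have "2 * (\<Sum>i<n. (?x i)\<^sup>2) \<le> dirichlet E n ?x"
    by (rule dirichlet_ge_of_dominating[OF sym S]) (use y0 in \<open>simp_all add: mult.commute\<close>)
  moreover have "(\<Sum>i<n. (?x i)\<^sup>2) = (\<Sum>l<k. (y l)\<^sup>2)"
    by (simp add: power2_eq_square eigenfamily_combination_product[OF u])
  moreover have "(\<Sum>l<k. d l * (y l)\<^sup>2) < (\<Sum>l<k. (y l)\<^sup>2)"
  proof (rule sum_strict_mono_ex1)
    have "d l * (y l)\<^sup>2 \<le> 1 * (y l)\<^sup>2" if "l < k" for l
      using d[OF that] by (intro mult_right_mono) auto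
    then show "\<forall>l\<in>{..<k}. d l * (y l)\<^sup>2 \<le> (y l)\<^sup>2" by simp
    obtain l where l: "l < k" "y l \<noteq> 0" using y by blast
    have "d l * (y l)\<^sup>2 < (y l)\<^sup>2"
      using mult_strict_right_mono[of "d l" 1 "(y l)\<^sup>2"] d[OF l(1)] l(2) by simp
    then show "\<exists>l\<in>{..<k}. d l * (y l)\<^sup>2 < (y l)\<^sup>2" using l(1) by blast
  qed simp
  ultimately show False by (simp add: dirichlet_combination[OF u])
qed

text \<open>The all-ones vector, an eigenvector of the complement for the eigenvalue 0, is orthogonal to
  the eigenvectors for nonzero eigenvalues; adding it to their span yields the strict inequality.\<close>

lemma eigenvalues_above_less:
  assumes S: "dominating (\<lambda>i j. \<not> E i j) {..<n} S" and n: "n \<ge> 1"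
  shows "size {#x \<in># proots (char_poly A). x \<in> {real n - 1<..real n}#} < card S"
proof (rule ccontr)
  define k where "k = size {#x \<in># proots (char_poly A). x \<in> {real n - 1<..real n}#}"
  assume "\<not> ?thesis"
  then have "card S < Suc k" by (simp add: k_def)
  obtain u d where d: "\<And>l. l < k \<Longrightarrow> d l \<in> {real n - 1<..real n}"
    and u: "eigenfamily A n k u d"
    using symmetric_eigenfamily[OF A k_def] by blast
  have SV: "S \<subseteq> {..<n}" using S by (simp add: dominating_def)
  then have "finite S" using finite_subset by blast
  \<comment> \<open>Unknown number \<open>k\<close> is the coefficient of the all-ones
    vector.\<close>
  then obtain y where y: "\<exists>l<Suc k. y l \<noteq> 0"
    and y0: "\<forall>s\<in>S. (\<Sum>l<Suc k. (if l = k then 1 else u l s) * y l) = 0"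
    using underdetermined_system_nontrivial[OF _ \<open>card S < Suc k\<close>,
        of "\<lambda>s l. if l = k then 1 else u l s"] by blast
  let ?x = "\<lambda>i. \<Sum>l<k. y l * u l i"
  have x0: "?x s + y k = 0" if "s \<in> S" for s using y0 that by (simp add: mult.commute)
  \<comment> \<open>Since \<open>d l > n - 1 \<ge> 0\<close>, the eigenvalues are nonzero and their
    eigenvectors orthogonal to the constants.\<close>
  have sum0: "(\<Sum>i<n. ?x i) = 0"
  proof -
    have "(\<Sum>i<n. u l i) = 0" if "l < k" for l
      by (rule eigenvector_sum_zero[of _ "d l"]) (use that u d[OF that] n in \<open>auto simp: eigenfamily_def\<close>)
    then show ?thesis by (subst sum.swap) (simp flip: sum_distrib_left)
  qed
  have "0 \<in> {..<n}" using n by simp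
  then have "S \<noteq> {}" using S unfolding dominating_def by blast
  then obtain s where "s \<in> S" by blast
  \<comment> \<open>Otherwise the combination would be a nonzero constant, which cannot vanish on
    the nonempty set \<open>S\<close>.\<close>
  have yk: "\<exists>l<k. y l \<noteq> 0"
  proof (rule ccontr)
    assume "\<not> ?thesis"
    then have "\<forall>l<k. y l = 0" by blast
    then show False using x0[OF \<open>s \<in> S\<close>] y by (auto simp: less_Suc_eq)
  qed
  \<comment> \<open>The shifted vector vanishes on \<open>S\<close>. The shift leaves the form
    unchanged and, as \<open>?x\<close> sums to 0, cannot decrease the norm, so the bound passes to
    \<open>?x\<close>.\<close>
  have "2 * (\<Sum>i<n. (?x i + y k)\<^sup>2) \<le> dirichlet (\<lambda>i j. \<not> E i j) n (\<lambda>i. ?x i + y k)"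
    by (rule dirichlet_ge_of_dominating[OF _ S]) (use x0 sym in auto)
  moreover have "(\<Sum>i<n. (?x i + y k)\<^sup>2) = (\<Sum>i<n. (?x i)\<^sup>2) + 2 * y k * (\<Sum>i<n. ?x i) + n * (y k)\<^sup>2"
    by (simp add: power2_sum sum.distrib sum_distrib_left mult_ac)
  moreover have "0 \<le> real n * (y k)\<^sup>2" by simp
  ultimately have "2 * (\<Sum>i<n. (?x i)\<^sup>2) \<le> dirichlet (\<lambda>i j. \<not> E i j) n ?x"
    unfolding sum0 dirichlet_shift by linarith
  \<comment> \<open>Hence the form of \<open>E\<close> is at most 2 (n - 1) times the squared norm
    of \<open>?x\<close>, whereas eigenvalues above n - 1 make it larger.\<close>
  moreover have "dirichlet E n ?x + dirichlet (\<lambda>i j. \<not> E i j) n ?x = 2 * (n * (\<Sum>i<n. (?x i)\<^sup>2))"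
    using dirichlet_complement[of E n ?x] sum0 by simp
  moreover have "(\<Sum>i<n. (?x i)\<^sup>2) = (\<Sum>l<k. (y l)\<^sup>2)"
    by (simp add: power2_eq_square eigenfamily_combination_product[OF u])
  moreover have "(\<Sum>l<k. (real n - 1) * (y l)\<^sup>2) < (\<Sum>l<k. d l * (y l)\<^sup>2)"
  proof (rule sum_strict_mono_ex1)
    have "(real n - 1) * (y l)\<^sup>2 \<le> d l * (y l)\<^sup>2" if "l < k" for l
      using d[OF that] by (intro mult_right_mono) auto
    then show "\<forall>l\<in>{..<k}. (real n - 1) * (y l)\<^sup>2 \<le> d l * (y l)\<^sup>2" by simp
    obtain l where l: "l < k" "y l \<noteq> 0" using yk by blast
    have "(real n - 1) * (y l)\<^sup>2 < d l * (y l)\<^sup>2"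
      using d[OF l(1)] l by (intro mult_strict_right_mono) auto
    then show "\<exists>l\<in>{..<k}. (real n - 1) * (y l)\<^sup>2 < d l * (y l)\<^sup>2" using l(1) by blast
  qed simp
  then have "(real n - 1) * (\<Sum>l<k. (y l)\<^sup>2) < (\<Sum>l<k. d l * (y l)\<^sup>2)"
    by (simp add: sum_distrib_left)
  ultimately show False by (simp add: dirichlet_combination[OF u] left_diff_distrib)
qed

end

section \<open>The Laplacian matrix of a graph, and the final inequality\<close>

text \<open>Counting the degree as a sum over neighbours merges it with the adjacency term into a
  sum of differences.\<close>

lemma laplacian_laplacian_matrix:
  assumes G: "pair_graph G" and vs: "distinct vs" "set vs = pverts G"
  shows "laplacian (\<lambda>i j. (vs ! i, vs ! j) \<in> parcs G) (length vs) (laplacian_matrix G vs)"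
proof -
  interpret pair_graph G by (rule G)
  let ?n = "length vs" and ?L = "laplacian_matrix G vs"
  let ?E = "\<lambda>i j. (vs ! i, vs ! j) \<in> parcs G"
  have E_sym: "(b, a) \<in> parcs G" if "(a, b) \<in> parcs G" for a b
    using pair_sym_arcs that by (auto simp: symmetric_def sym_def)
  have L: "?L $$ (i, j) = (if i = j then real (out_degree (with_proj G) (vs ! i)) else 0) - of_bool (?E i j)"
    if "i < ?n" "j < ?n" for i j
    using that by (simp add: laplacian_matrix_def degree_matrix_def adjacency_matrix_def)
  have deg: "real (out_degree (with_proj G) (vs ! i)) = (\<Sum>j<?n. of_bool (?E i j))" for i
  proof -
    have "out_arcs (with_proj G) (vs ! i) = (\<lambda>j. (vs ! i, vs ! j)) ` {j \<in> {..<?n}. ?E i j}"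
      (is "_ = ?R")
    proof (rule Set.set_eqI)
      fix a
      have "a \<in> ?R" if a: "a \<in> parcs G" "fst a = vs ! i"
      proof -
        have "snd a \<in> set vs" using a(1) vs(2) in_arcsD2[of "fst a" "snd a"] by simp
        then obtain j where "j < ?n" "snd a = vs ! j" by (metis in_set_conv_nth)
        then show ?thesis using a by (cases a) auto
      qed
      then show "a \<in> out_arcs (with_proj G) (vs ! i) \<longleftrightarrow> a \<in> ?R"
        by (auto simp: out_arcs_def)
    qed
    moreover have "inj_on (\<lambda>j. (vs ! i, vs ! j)) {j \<in> {..<?n}. ?E i j}"
      using vs(1) by (auto simp: inj_on_def nth_eq_iff_index_eq)
    ultimately have "out_degree (with_proj G) (vs ! i) = card {j \<in> {..<?n}. ?E i j}"
      by (simp add: out_degree_def card_image)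
    then show ?thesis by (simp add: of_bool_def sum.If_cases Int_def)
  qed
  show ?thesis
  proof
    show "?E j i" if "?E i j" for i j using that by (rule E_sym)
    show "?L \<in> carrier_mat ?n ?n"
      by (intro carrier_matI)
         (simp_all add: laplacian_matrix_def degree_matrix_def adjacency_matrix_def)
    then show "transpose_mat ?L = ?L"
      by (intro eq_matI) (auto simp: L dest: E_sym)
    show "(\<Sum>j<?n. ?L $$ (i, j) * x j) = (\<Sum>j<?n. of_bool (?E i j) * (x i - x j))"
      if "i < ?n" for i and x :: "nat \<Rightarrow> real"
    proof -
      have "(\<Sum>j<?n. ?L $$ (i, j) * x j) =
          (\<Sum>j<?n. (if j = i then real (out_degree (with_proj G) (vs ! i)) * x i else 0)
            - of_bool (?E i j) * x j)"
        using that by (intro sum.cong) (auto simp: L left_diff_distrib)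
      also have "\<dots> = (\<Sum>j<?n. of_bool (?E i j)) * x i - (\<Sum>j<?n. of_bool (?E i j) * x j)"
        using that by (simp add: sum_subtractf deg)
      finally show ?thesis by (simp add: sum_distrib_right right_diff_distrib sum_subtractf)
    qed
  qed
qed

theorem theorem6:
  fixes G :: "'a pair_pre_digraph" and n :: nat
  assumes "pair_graph G" and "n = card (pverts G)" and "n \<ge> 1"
  shows "laplacian_count G {0..<1} * laplacian_count G {real n - 1<..real n} < n"
proof -
  interpret G: pair_graph G by (rule assms(1))
  obtain vs where vs: "distinct vs" "set vs = pverts G"
    using finite_distinct_list[OF G.pair_finite_verts] by blast
  have len: "length vs = n" using distinct_card[OF vs(1)] vs(2) assms(2) by simp
  let ?E = "\<lambda>i j. (vs ! i, vs ! j) \<in> parcs G"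
  interpret laplacian ?E n "laplacian_matrix G vs"
    using laplacian_laplacian_matrix[OF assms(1) vs] len by simp
  let ?a = "laplacian_count G {0..<1}" and ?b = "laplacian_count G {real n - 1<..real n}"
  \<comment> \<open>The strict bound in \<open>eigenvalues_above_less\<close> allows
    \<open>Suc ?b\<close>. For \<open>?a > 0\<close> this makes the product of the counts strictly
    less than \<open>n\<close>; for \<open>?a = 0\<close> the product is 0 and
    \<open>n \<ge> 1\<close> suffices.\<close>
  have "?a * Suc ?b \<le> card {..<n}"
  proof (rule dominating_complement_product_le[of _ ?E])
    show "?E j i" if "?E i j" for i j using that by (rule sym)
    show "?a \<le> card D" if "dominating ?E {..<n} D" for D
      using eigenvalues_below_one_le[OF that]
      by (simp add: laplacian_count_def laplacian_eigenvalues_eq[OF vs])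
    show "Suc ?b \<le> card D" if "dominating (\<lambda>i j. \<not> ?E i j) {..<n} D" for D
      using eigenvalues_above_less[OF that assms(3)]
      by (simp add: laplacian_count_def laplacian_eigenvalues_eq[OF vs])
  qed simp
  then show ?thesis using assms(3) by (cases "?a = 0") auto
qed

end
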